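(* Let $p$ and $m$ be positive integers. The automaton $\mathcal{M}_{m,\mathcal{T},2^p}$ (defined in the context) is the minimal automaton of the language $\mathrm{val}_{2^p}^{-1}(m\mathcal{T})$ over the alphabet $A_{2^p}$.
   Context: $\mathbb{N}=\{0,1,2,\ldots\}$; $[\![a,b]\!]$ is the set of integers $n$ with $a\le n\le b$. The Thue-Morse set $\mathcal{T}$ is the set of all $n\in\mathbb{N}$ whose base-2 expansion contains an even number of digits $1$ (so $0\in\mathcal{T}$); $m\mathcal{T}=\{mt\colon t\in\mathcal{T}\}$. For an integer $b\ge 2$, $A_b=\{0,\ldots,b-1\}$; for $w=c_{\ell-1}\cdots c_0\in A_b^*$, $\mathrm{val}_b(w)=\sum_j c_jb^j$; $\mathrm{val}_b^{-1}(X)=\{w\in A_b^*\colon\mathrm{val}_b(w)\in X\}$. Write $m=k2^z$ with $k$ odd. Let $T,B$ be two symbols, $\overline T=B$, $\overline B=T$. For $X\in\{T,B\}$ and $n\in\mathbb{N}$, put $X_n=X$ if $n\in\mathcal{T}$ and $X_n=\overline X$ otherwise. The automaton $\Pi(\mathcal{A}_{m,2^p}\times\mathcal{A}_{\mathcal{T},2^p})$ over $A_{2^p}$ has set of states $[\![0,m-1]\!]\times\{T,B\}$; the state $(0,T)$ is initial and is the only final state; there is a transition labeled $e\in A_{2^p}$ from $(i,X)$ to $(j,Y)$ if and only if there exists $d\in A_{2^p}$ with $2^pi+e=md+j$ and $Y=X_d$. Classes of states: $[(0,T)]=\{(0,T)\}$; for $(j,X)\in([\![1,k-1]\!]\times\{T,B\})\cup\{(0,B)\}$,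 $[(j,X)]=\{(j+k\ell,X_\ell)\colon 0\le\ell\le 2^z-1\}$. For $\alpha\in[\![0,z-1]\!]$, $C_\alpha=\{(k2^{z-\alpha-1}+k2^{z-\alpha}\ell,\,B_\ell)\colon \ell\in[\![0,2^\alpha-1]\!]\}$. For $\beta\in[\![0,\lceil z/p\rceil-2]\!]$, $\Gamma_\beta=\bigcup_{\alpha=\beta p}^{\beta p+p-1}C_\alpha$; and, if $z\ge1$, $\Gamma_{\lceil z/p\rceil-1}=\bigcup_{\alpha=(\lceil z/p\rceil-1)p}^{z-1}C_\alpha$. (These classes form a partition of the state set of $\Pi(\mathcal{A}_{m,2^p}\times\mathcal{A}_{\mathcal{T},2^p})$.) The automaton $\mathcal{M}_{m,\mathcal{T},2^p}$ over $A_{2^p}$ has as states the classes $[(j,X)]$ for $(j,X)\in[\![0,k-1]\!]\times\{T,B\}$ and the classes $\Gamma_\beta$ for $\beta\in[\![0,\lceil z/p\rceil-1]\!]$. The class $[(0,T)]$ is the initial state and the only final state. There is a transition labeled $a\in A_{2^p}$ from a class $J_1$ to a class $J_2$ if and only if there exist $j_1\in J_1$ and $j_2\in J_2$ such that $\Pi(\mathcal{A}_{m,2^p}\times\mathcal{A}_{\mathcal{T},2^p})$ has a transition labeled $a$ from $j_1$ to $j_2$. A DFA is the minimal automaton of the language it accepts if and only if it is deterministic, complete (total transition function), accessible (every state is reachable from the initial state) and reduced (distinct states accept distinct languages). *)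

theory Defs
  imports Complex_Main "HOL-Computational_Algebra.Primes"
begin

subsection \<open>Automata\<close>

record ('q, 'a) automaton =
  states :: "'q set"
  alphabet :: "'a set"
  initial :: 'q
  final :: "'q set"
  trans_rel :: "('q \<times> 'a \<times> 'q) set"

definition wf_automaton :: "('q, 'a) automaton \<Rightarrow> bool" where
  "wf_automaton M \<longleftrightarrow> finite (states M) \<and> finite (alphabet M) \<and>
     initial M \<in> states M \<and> final M \<subseteq> states M \<and>
     trans_rel M \<subseteq> states M \<times> alphabet M \<times> states M"

fun path :: "('q, 'a) automaton \<Rightarrow> 'q \<Rightarrow> 'a list \<Rightarrow> 'q \<Rightarrow> bool" where
  "path M q [] r \<longleftrightarrow> q = r"
| "path M q (a # w) r \<longleftrightarrow> (\<exists>q'. (q, a, q') \<in> trans_rel M \<and> path M q' w r)"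

definition lang_from :: "('q, 'a) automaton \<Rightarrow> 'q \<Rightarrow> 'a list set" where
  "lang_from M q = {w \<in> lists (alphabet M). \<exists>r \<in> final M. path M q w r}"

definition lang :: "('q, 'a) automaton \<Rightarrow> 'a list set" where
  "lang M = lang_from M (initial M)"

definition deterministic :: "('q, 'a) automaton \<Rightarrow> bool" where
  "deterministic M \<longleftrightarrow>
     (\<forall>q a r r'. (q, a, r) \<in> trans_rel M \<and> (q, a, r') \<in> trans_rel M \<longrightarrow> r = r')"

definition complete :: "('q, 'a) automaton \<Rightarrow> bool" where
  "complete M \<longleftrightarrow>
     (\<forall>q \<in> states M. \<forall>a \<in> alphabet M. \<exists>r \<in> states M. (q, a, r) \<in> trans_rel M)"

definition accessible :: "('q, 'a) automaton \<Rightarrow> bool" where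
  "accessible M \<longleftrightarrow>
     (\<forall>q \<in> states M. \<exists>w \<in> lists (alphabet M). path M (initial M) w q)"

definition reduced :: "('q, 'a) automaton \<Rightarrow> bool" where
  "reduced M \<longleftrightarrow>
     (\<forall>q \<in> states M. \<forall>r \<in> states M. q \<noteq> r \<longrightarrow> lang_from M q \<noteq> lang_from M r)"

definition minimal_automaton_of :: "('q, 'a) automaton \<Rightarrow> 'a list set \<Rightarrow> bool" where
  "minimal_automaton_of M L \<longleftrightarrow>
     wf_automaton M \<and> deterministic M \<and> complete M \<and> accessible M \<and> reduced M \<and> lang M = L"


subsection \<open>The Thue-Morse set and positional numeration\<close>

definition thue_morse :: "nat set" where
  "thue_morse = {n. even (card {i. bit n i})}"

definition digits :: "nat \<Rightarrow> nat set" where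
  "digits b = {0..<b}"

text \<open>Words are written with the most significant digit first, so the digit of weight
  \<open>b ^ j\<close> is the \<open>j\<close>-th letter of the reversed word.\<close>

definition val :: "nat \<Rightarrow> nat list \<Rightarrow> nat" where
  "val b w = (\<Sum>j<length w. rev w ! j * b ^ j)"

definition val_inv :: "nat \<Rightarrow> nat set \<Rightarrow> nat list set" where
  "val_inv b X = {w \<in> lists (digits b). val b w \<in> X}"


subsection \<open>The projected product automaton\<close>

datatype tm_sym = T | B

fun bar :: "tm_sym \<Rightarrow> tm_sym" where
  "bar T = B"
| "bar B = T"

definition tm_shift :: "tm_sym \<Rightarrow> nat \<Rightarrow> tm_sym" where
  "tm_shift X n = (if n \<in> thue_morse then X else bar X)"

definition proj_product :: "nat \<Rightarrow> nat \<Rightarrow> (nat \<times> tm_sym, nat) automaton" where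
  "proj_product m p =
     \<lparr> states = {0..<m} \<times> UNIV,
       alphabet = digits (2 ^ p),
       initial = (0, T),
       final = {(0, T)},
       trans_rel = {((i, X), e, (j, Y)) | i X e j Y.
         i \<in> {0..<m} \<and> j \<in> {0..<m} \<and> e \<in> digits (2 ^ p) \<and>
         (\<exists>d \<in> digits (2 ^ p). 2 ^ p * i + e = m * d + j \<and> Y = tm_shift X d)} \<rparr>"


subsection \<open>The classes and the quotient automaton\<close>

text \<open>In this subsection, \<open>k\<close> is the odd part of \<open>m\<close> and \<open>z\<close> its \<open>2\<close>-adic valuation.\<close>

definition state_class :: "nat \<Rightarrow> nat \<Rightarrow> nat \<times> tm_sym \<Rightarrow> (nat \<times> tm_sym) set" where
  "state_class k z s =
     (if s = (0, T) then {(0, T)}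
      else {(fst s + k * l, tm_shift (snd s) l) | l. l < 2 ^ z})"

text \<open>Only used for \<open>\<alpha> < z\<close>, so the subtractions do not truncate.\<close>

definition C_class :: "nat \<Rightarrow> nat \<Rightarrow> nat \<Rightarrow> (nat \<times> tm_sym) set" where
  "C_class k z \<alpha> =
     {(k * 2 ^ (z - \<alpha> - 1) + k * 2 ^ (z - \<alpha>) * l, tm_shift B l) | l. l < 2 ^ \<alpha>}"

definition num_Gamma :: "nat \<Rightarrow> nat \<Rightarrow> nat" where
  "num_Gamma z p = nat \<lceil>real z / real p\<rceil>"

text \<open>The first branch covers \<open>\<beta> \<le> \<lceil>z / p\<rceil> - 2\<close>, the second \<open>\<beta> = \<lceil>z / p\<rceil> - 1\<close>.\<close>

definition Gamma_class :: "nat \<Rightarrow> nat \<Rightarrow> nat \<Rightarrow> nat \<Rightarrow> (nat \<times> tm_sym) set" where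
  "Gamma_class k z p \<beta> =
     (if \<beta> + 1 < num_Gamma z p
      then (\<Union>\<alpha> \<in> {\<beta> * p ..< \<beta> * p + p}. C_class k z \<alpha>)
      else (\<Union>\<alpha> \<in> {\<beta> * p ..< z}. C_class k z \<alpha>))"

definition quotient_states :: "nat \<Rightarrow> nat \<Rightarrow> nat \<Rightarrow> (nat \<times> tm_sym) set set" where
  "quotient_states k z p =
     state_class k z ` ({0..<k} \<times> UNIV) \<union> Gamma_class k z p ` {0..<num_Gamma z p}"

definition M_automaton :: "nat \<Rightarrow> nat \<Rightarrow> ((nat \<times> tm_sym) set, nat) automaton" where
  "M_automaton m p =
     (let z = multiplicity 2 m; k = m div 2 ^ z in
      \<lparr> states = quotient_states k z p,
        alphabet = digits (2 ^ p),
        initial = state_class k z (0, T),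
        final = {state_class k z (0, T)},
        trans_rel = {(J1, a, J2).
          J1 \<in> quotient_states k z p \<and> a \<in> digits (2 ^ p) \<and> J2 \<in> quotient_states k z p \<and>
          (\<exists>j1 \<in> J1. \<exists>j2 \<in> J2. (j1, a, j2) \<in> trans_rel (proj_product m p))} \<rparr>)"

end

theory Submission
  imports Defs
begin

text \<open>From a state \<open>(i, X)\<close> the projected product accepts a word of length \<open>n\<close> and value \<open>v\<close>
  iff \<open>2 ^ (p * n) * i + v = m * d\<close> for some \<open>d\<close> with \<open>tm_shift X d = T\<close>.  Every state is
  uniquely of the form \<open>(j + k * l, tm_shift X l)\<close> with \<open>j < k\<close> and \<open>l < 2 ^ z\<close>.  As the
  Thue-Morse sequence is additive over blocks of binary digits, words with \<open>z \<le> p * n\<close> are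
  accepted independently of \<open>l\<close>, and such words separate any two distinct pairs \<open>(j, X)\<close>.
  Shorter words are accepted only from \<open>(j, X) = (0, T)\<close> and if \<open>v = 0\<close> and
  \<open>2 ^ (z - p * n)\<close> divides \<open>l\<close>, so that only the 2-adic valuation of \<open>l\<close> matters, at
  resolution \<open>p\<close>.  Hence the classes are exactly the classes of states accepting the same
  language.\<close>

subsection \<open>Quotients by language equality\<close>

lemma Cons_in_lang_from_iff:
  assumes "deterministic A" "(q, a, r) \<in> trans_rel A" "a \<in> alphabet A"
  shows "a # w \<in> lang_from A q \<longleftrightarrow> w \<in> lang_from A r"
proof -
  have "path A q (a # w) f \<longleftrightarrow> path A r w f" for f
    using assms unfolding deterministic_def by (metis path.simps(2))
  with assms show ?thesis by (simp add: lang_from_def)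
qed

text \<open>The states of \<open>M\<close> are the classes of the relation "same accepted language"
  on the states of \<open>A\<close>. \<open>lang_eq_iff\<close> also makes them disjoint: taking
  \<open>s = s'\<close> forces \<open>J = J'\<close>.\<close>

locale nerode_quotient =
  fixes A :: "('q, 'a) automaton" and M :: "('q set, 'a) automaton"
  assumes wf: "wf_automaton A" and det: "deterministic A" and compl: "complete A"
    and acc: "accessible A"
    and cover: "\<Union> (states M) = states A" and nonempty: "{} \<notin> states M"
    and lang_eq_iff: "\<And>J J' s s'. \<lbrakk>J \<in> states M; J' \<in> states M; s \<in> J; s' \<in> J'\<rbrakk> \<Longrightarrow>
           lang_from A s = lang_from A s' \<longleftrightarrow> J = J'"
    and alphabet_eq: "alphabet M = alphabet A"
    and initial_in: "initial M \<in> states M" "initial A \<in> initial M"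
    and final_eq: "final M = {J \<in> states M. \<exists>s \<in> J. s \<in> final A}"
    and trans_eq: "trans_rel M = {(J1, a, J2). J1 \<in> states M \<and> a \<in> alphabet A \<and> J2 \<in> states M \<and>
           (\<exists>j1 \<in> J1. \<exists>j2 \<in> J2. (j1, a, j2) \<in> trans_rel A)}"
begin

text \<open>Members of \<open>J\<close> accept the same language, so by determinism their successors
  under \<open>a\<close> do too and lie in one class. Hence the existentially defined transitions of
  \<open>M\<close> do not depend on the chosen member.\<close>

lemma trans_iff:
  assumes J: "J \<in> states M" "s \<in> J" and t: "(s, a, t) \<in> trans_rel A"
  shows "(J, a, J') \<in> trans_rel M \<longleftrightarrow> J' \<in> states M \<and> t \<in> J'"
proof
  have a: "a \<in> alphabet A" and tA: "t \<in> states A"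
    using t wf unfolding wf_automaton_def by auto
  show "J' \<in> states M \<and> t \<in> J' \<Longrightarrow> (J, a, J') \<in> trans_rel M"
    using J t a unfolding trans_eq by blast
  assume "(J, a, J') \<in> trans_rel M"
  then obtain j1 j2 where j: "J' \<in> states M" "j1 \<in> J" "j2 \<in> J'" "(j1, a, j2) \<in> trans_rel A"
    unfolding trans_eq by blast
  have "lang_from A j1 = lang_from A s" using lang_eq_iff J j by blast
  then have "lang_from A j2 = lang_from A t"
    using Cons_in_lang_from_iff[OF det j(4) a] Cons_in_lang_from_iff[OF det t a] by blast
  moreover obtain J2 where "J2 \<in> states M" "t \<in> J2" using tA cover by blast
  ultimately show "J' \<in> states M \<and> t \<in> J'" using lang_eq_iff j by blast
qed

lemma step_exists:
  assumes "s \<in> states A" "a \<in> alphabet A"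
  obtains t where "t \<in> states A" "(s, a, t) \<in> trans_rel A"
  using compl assms unfolding complete_def by blast

lemma path_iff:
  assumes "J \<in> states M" "s \<in> J" "w \<in> lists (alphabet A)"
  shows "path M J w R \<longleftrightarrow> R \<in> states M \<and> (\<exists>r \<in> R. path A s w r)"
  using assms
proof (induction w arbitrary: J s)
  case Nil
  then show ?case using lang_eq_iff by auto
next
  case (Cons a w)
  have w: "w \<in> lists (alphabet A)" and "a \<in> alphabet A" using Cons.prems by auto
  moreover have "s \<in> states A" using Cons.prems cover by auto
  ultimately obtain t where t: "t \<in> states A" "(s, a, t) \<in> trans_rel A"
    using step_exists by metis
  then obtain J' where J': "J' \<in> states M" "t \<in> J'" using cover by blast
  have "path M J (a # w) R \<longleftrightarrow> path M J' w R"
    using trans_iff[OF Cons.prems(1,2) t(2)] J' lang_eq_iff by (metis path.simps(2))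
  also have "\<dots> \<longleftrightarrow> R \<in> states M \<and> (\<exists>r \<in> R. path A t w r)"
    using Cons.IH J' w by blast
  also have "(\<exists>r \<in> R. path A t w r) \<longleftrightarrow> (\<exists>r \<in> R. path A s (a # w) r)"
    using det t(2) unfolding deterministic_def by (metis path.simps(2))
  finally show ?case .
qed

text \<open>Finality is acceptance of the empty word, so it is constant on each class.\<close>

lemma final_iff:
  assumes "R \<in> states M" "r \<in> R"
  shows "R \<in> final M \<longleftrightarrow> r \<in> final A"
proof -
  have "s \<in> final A \<longleftrightarrow> [] \<in> lang_from A s" for s by (simp add: lang_from_def)
  then show ?thesis using assms lang_eq_iff unfolding final_eq by blast
qed

lemma path_states:
  assumes "path A s w r" "s \<in> states A"
  shows "r \<in> states A"
  using assms
proof (induction w arbitrary: s)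
  case (Cons a w)
  then show ?case using wf unfolding wf_automaton_def by auto
qed simp

text \<open>Paths of \<open>A\<close> project to paths of \<open>M\<close> by
  \<open>path_iff\<close>, and \<open>final_iff\<close> matches their endpoints. Together with
  \<open>lang_eq_iff\<close> this makes \<open>M\<close> reduced.\<close>

lemma lang_from_quotient:
  assumes "J \<in> states M" "s \<in> J"
  shows "lang_from M J = lang_from A s"
proof -
  have "(\<exists>R \<in> final M. path M J w R) \<longleftrightarrow> (\<exists>r \<in> final A. path A s w r)"
    if w: "w \<in> lists (alphabet A)" for w
  proof
    assume "\<exists>R \<in> final M. path M J w R"
    then show "\<exists>r \<in> final A. path A s w r"
      using path_iff[OF assms w] final_iff by blast
  next
    assume "\<exists>r \<in> final A. path A s w r"
    then obtain r where r: "r \<in> final A" "path A s w r" by blast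
    then have "r \<in> states A" using path_states assms cover by blast
    then obtain R where "R \<in> states M" "r \<in> R" using cover by blast
    then show "\<exists>R \<in> final M. path M J w R"
      using path_iff[OF assms w] final_iff r by blast
  qed
  then show ?thesis unfolding lang_from_def alphabet_eq by blast
qed

lemma minimal: "minimal_automaton_of M (lang A)"
proof -
  have rep: "\<exists>s. s \<in> J \<and> s \<in> states A" if "J \<in> states M" for J
    using that nonempty cover by (metis UnionI equals0I)
  have "wf_automaton M"
  proof -
    have "finite (states M)"
      using cover wf finite_UnionD unfolding wf_automaton_def by metis
    then show ?thesis
      using wf initial_in alphabet_eq unfolding wf_automaton_def final_eq trans_eq by auto
  qed
  moreover have "deterministic M"
    unfolding deterministic_def
  proof (intro allI impI)
    fix J a R R' assume *: "(J, a, R) \<in> trans_rel M \<and> (J, a, R') \<in> trans_rel M"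
    then obtain s t where J: "J \<in> states M" "s \<in> J" "(s, a, t) \<in> trans_rel A"
      unfolding trans_eq by blast
    then show "R = R'" using * trans_iff[OF J] lang_eq_iff by blast
  qed
  moreover have "complete M"
    unfolding complete_def
  proof (intro ballI)
    fix J a assume J: "J \<in> states M" and "a \<in> alphabet M"
    moreover obtain s where s: "s \<in> J" "s \<in> states A" using rep J by blast
    ultimately obtain t where t: "t \<in> states A" "(s, a, t) \<in> trans_rel A"
      using step_exists alphabet_eq by metis
    then obtain R where "R \<in> states M" "t \<in> R" using cover by blast
    then show "\<exists>R \<in> states M. (J, a, R) \<in> trans_rel M" using trans_iff J s t by blast
  qed
  moreover have "accessible M"
    unfolding accessible_def
  proof
    fix J assume J: "J \<in> states M"
    then obtain s where s: "s \<in> J" "s \<in> states A" using rep by blast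
    then obtain w where w: "w \<in> lists (alphabet A)" "path A (initial A) w s"
      using acc unfolding accessible_def by blast
    then show "\<exists>w \<in> lists (alphabet M). path M (initial M) w J"
      using path_iff[OF initial_in w(1)] s J alphabet_eq by auto
  qed
  moreover have "reduced M"
    unfolding reduced_def using rep lang_from_quotient lang_eq_iff by metis
  moreover have "lang M = lang A"
    unfolding lang_def using lang_from_quotient initial_in by blast
  ultimately show ?thesis unfolding minimal_automaton_of_def by blast
qed

end

subsection \<open>Thue-Morse shifts and positional values\<close>

lemma finite_bits: "finite {i. bit (n::nat) i}"
proof (rule finite_subset)
  show "{i. bit n i} \<subseteq> {..<n}"
  proof
    fix i assume "i \<in> {i. bit n i}"
    then have "2 ^ i \<le> n" by (auto simp: bit_iff_odd div_eq_0_iff intro: leI dest: odd_pos)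
    then show "i \<in> {..<n}" using less_le_trans[OF less_exp] by blast
  qed
qed simp

lemma bit_block:
  fixes a b :: nat
  assumes "b < 2 ^ N"
  shows "bit (2 ^ N * a + b) i \<longleftrightarrow> (if i < N then bit b i else bit a (i - N))"
proof (cases "i < N")
  case True
  \<comment> \<open>The extra factor 2 makes the contribution of \<open>a\<close> to the quotient by
    \<open>2 ^ i\<close> even, so it cannot affect bit \<open>i\<close>.\<close>
  then have "(2::nat) ^ N = 2 ^ i * (2 * 2 ^ (N - i - 1))"
    by (simp flip: power_Suc power_add)
  then have "2 ^ N * a + b = 2 ^ i * (2 * (2 ^ (N - i - 1) * a)) + b"
    by (simp only: mult.assoc)
  then have "(2 ^ N * a + b) div 2 ^ i = 2 * (2 ^ (N - i - 1) * a) + b div 2 ^ i"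
    by (simp only: div_mult_self4 power_not_zero zero_neq_numeral[symmetric] not_False_eq_True)
  then show ?thesis using True by (simp add: bit_iff_odd)
next
  case False
  then have "(2::nat) ^ i = 2 ^ N * 2 ^ (i - N)" by (simp flip: power_add)
  then have "(2 ^ N * a + b) div 2 ^ i = a div 2 ^ (i - N)"
    using assms by (simp add: div_mult2_eq)
  then show ?thesis using False by (simp add: bit_iff_odd)
qed

text \<open>The set of bits is the disjoint union of the bits of \<open>b\<close>, all below
  \<open>N\<close>, and those of \<open>a\<close> moved up by \<open>N\<close>; the parities of the
  two cardinalities add.\<close>

lemma thue_morse_block:
  assumes "b < 2 ^ N"
  shows "2 ^ N * a + b \<in> thue_morse \<longleftrightarrow> (a \<in> thue_morse \<longleftrightarrow> b \<in> thue_morse)"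
proof -
  have lt: "i < N" if "bit b i" for i
  proof (rule ccontr)
    assume "\<not> i < N"
    then have "b < 2 ^ i" using assms by (meson less_le_trans not_less one_le_numeral power_increasing)
    then show False using that by (simp add: bit_iff_odd)
  qed
  have "{i. bit (2 ^ N * a + b) i} = {i. bit b i} \<union> (\<lambda>i. i + N) ` {i. bit a i}"
  proof (rule set_eqI)
    fix i
    show "i \<in> {i. bit (2 ^ N * a + b) i} \<longleftrightarrow> i \<in> {i. bit b i} \<union> (\<lambda>i. i + N) ` {i. bit a i}"
      using lt[of i] by (cases "i < N") (auto simp: bit_block[OF assms] image_iff
          intro!: exI[of _ "i - N"])
  qed
  moreover have "{i. bit b i} \<inter> (\<lambda>i. i + N) ` {i. bit a i} = {}" using lt by fastforce
  ultimately have "card {i. bit (2 ^ N * a + b) i} = card {i. bit b i} + card {i. bit a i}"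
    by (simp add: card_Un_disjoint finite_bits card_image)
  then show ?thesis by (simp add: thue_morse_def) blast
qed

lemma zero_in_thue_morse: "0 \<in> thue_morse"
proof -
  have "{i. bit (0::nat) i} = {}" by simp
  then show ?thesis by (simp only: thue_morse_def mem_Collect_eq card.empty even_zero)
qed

lemma one_notin_thue_morse: "1 \<notin> thue_morse"
proof -
  have "{i. bit (1::nat) i} = {0}" by (auto simp: bit_iff_odd simp flip: One_nat_def intro: gr0I)
  then show ?thesis by (simp add: thue_morse_def)
qed

lemma finite_tm_sym: "finite (UNIV :: tm_sym set)"
proof (rule finite_subset)
  show "UNIV \<subseteq> {T, B}" using tm_sym.exhaust by blast
qed simp

lemma bar_bar [simp]: "bar (bar X) = X" and bar_neq [simp]: "bar X \<noteq> X" "X \<noteq> bar X"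
  by (cases X; simp)+

lemma tm_shift_0 [simp]: "tm_shift X 0 = X"
  by (simp add: tm_shift_def zero_in_thue_morse)

lemma tm_shift_self [simp]: "tm_shift (tm_shift X n) n = X"
  by (simp add: tm_shift_def)

lemma tm_shift_block:
  "b < 2 ^ N \<Longrightarrow> tm_shift X (2 ^ N * a + b) = tm_shift (tm_shift X a) b"
  by (auto simp: tm_shift_def thue_morse_block)

lemma tm_shift_double: "tm_shift X (2 ^ N * a) = tm_shift X a"
  using tm_shift_block[of 0 N X a] by simp

lemma tm_shift_odd: "tm_shift X (2 * a + 1) = bar (tm_shift X a)"
  using tm_shift_block[of 1 1 X a] one_notin_thue_morse by (simp add: tm_shift_def)

section \<open>Values of words\<close>

lemma val_Nil [simp]: "val b [] = 0"
  by (simp add: val_def)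

lemma val_Cons [simp]: "val b (a # w) = a * b ^ length w + val b w"
proof -
  have "(\<Sum>j<length w. (rev w @ [a]) ! j * b ^ j) = (\<Sum>j<length w. rev w ! j * b ^ j)"
    by (rule sum.cong) (auto simp: nth_append)
  then show ?thesis by (simp add: val_def nth_append)
qed

lemma val_less: "w \<in> lists (digits b) \<Longrightarrow> val b w < b ^ length w"
proof (induction w)
  case (Cons a w)
  then have "(a + 1) * b ^ length w \<le> b * b ^ length w"
    by (intro mult_right_mono) (auto simp: digits_def)
  with Cons show ?case by auto
qed simp

text \<open>Leading zeros are allowed, so the length can be prescribed; the first letter is
  \<open>v div b ^ n\<close> and the rest represents the remainder.\<close>

lemma val_surj:
  assumes "v < b ^ n"
  obtains w where "w \<in> lists (digits b)" "length w = n" "val b w = v"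
  using assms
proof (induction n arbitrary: v thesis)
  case 0
  then show ?case by (auto intro: 0(1)[of "[]"])
next
  case (Suc n)
  have "b > 0" using Suc.prems(2) by (cases b) auto
  then obtain w where w: "w \<in> lists (digits b)" "length w = n" "val b w = v mod b ^ n"
    using Suc.IH[of "v mod b ^ n"] by auto
  have "v div b ^ n < b"
    using Suc.prems(2) by (simp add: less_mult_imp_div_less)
  then show ?case
    using w by (intro Suc.prems(1)[of "(v div b ^ n) # w"])
      (simp_all add: digits_def div_mult_mod_eq)
qed

subsection \<open>The projected product\<close>

lemma proj_product_simps:
  "states (proj_product m p) = {0..<m} \<times> UNIV"
  "alphabet (proj_product m p) = digits (2 ^ p)"
  "initial (proj_product m p) = (0, T)"
  "final (proj_product m p) = {(0, T)}"
  by (simp_all add: proj_product_def)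

text \<open>Since \<open>j < m\<close>, the equation in the definition is a Euclidean division by
  \<open>m\<close>. Its quotient is automatically a digit, because \<open>i < m\<close> and
  \<open>e < 2 ^ p\<close>.\<close>

lemma trans_proj_product_iff:
  "((i, X), e, r) \<in> trans_rel (proj_product m p) \<longleftrightarrow>
     i < m \<and> e < 2 ^ p \<and>
     r = ((2 ^ p * i + e) mod m, tm_shift X ((2 ^ p * i + e) div m))"
proof -
  have "(2 ^ p * i + e) div m < 2 ^ p" if "i < m" "e < 2 ^ p"
  proof (rule less_mult_imp_div_less)
    have "2 ^ p * (i + 1) \<le> 2 ^ p * m" using that by (intro mult_left_mono) auto
    then show "2 ^ p * i + e < 2 ^ p * m" using that by simp
  qed
  then have "(\<exists>d \<in> digits (2 ^ p). 2 ^ p * i + e = m * d + j \<and> Y = tm_shift X d) \<longleftrightarrow>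
     j = (2 ^ p * i + e) mod m \<and> Y = tm_shift X ((2 ^ p * i + e) div m)"
    if "i < m" "j < m" "e < 2 ^ p" for j Y
    using that by (force simp: digits_def)
  then show ?thesis
    by (cases r) (auto simp: proj_product_def digits_def)
qed

text \<open>Reading a word is long division by \<open>m\<close>: the state keeps the remainder, and
  the symbol is shifted by each quotient digit. By \<open>tm_shift_block\<close> these shifts
  compose to the shift by the whole quotient.\<close>

lemma path_proj_product_iff:
  assumes "w \<in> lists (digits (2 ^ p))" "i < m"
  shows "path (proj_product m p) (i, X) w r \<longleftrightarrow>
    r = ((2 ^ (p * length w) * i + val (2 ^ p) w) mod m,
         tm_shift X ((2 ^ (p * length w) * i + val (2 ^ p) w) div m))"
  using assms
proof (induction w arbitrary: i X rule: list.induct)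
  case Nil
  then show ?case by auto
next
  case (Cons e w)
  define N where "N = p * length w"
  define v where "v = val (2 ^ p) w"
  define c where "c = 2 ^ p * i + e"
  have e: "e < 2 ^ p" and w: "w \<in> lists (digits (2 ^ p))" and m: "m > 0"
    using Cons.prems by (auto simp: digits_def)
  have v: "v < 2 ^ N" using val_less[OF w] by (simp add: v_def N_def power_mult)
  have split: "2 ^ (p * length (e # w)) * i + val (2 ^ p) (e # w) =
      m * (2 ^ N * (c div m)) + (2 ^ N * (c mod m) + v)" (is "?l = _")
  proof -
    have "?l = 2 ^ N * c + v"
      by (simp add: N_def c_def v_def power_add algebra_simps flip: power_mult)
    also have "2 ^ N * c = 2 ^ N * (m * (c div m) + c mod m)" by simp
    finally show ?thesis by (simp only: algebra_simps)
  qed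
  have "2 ^ N * (c mod m + 1) \<le> 2 ^ N * m"
    using m by (intro mult_left_mono) (auto simp: Suc_leI)
  \<comment> \<open>The quotient digits still to come fit in the \<open>N\<close> bits below
    \<open>c div m\<close>, as \<open>tm_shift_block\<close> requires.\<close>
  then have lt: "(2 ^ N * (c mod m) + v) div m < 2 ^ N"
    using v by (intro less_mult_imp_div_less) simp
  have "path (proj_product m p) (i, X) (e # w) r \<longleftrightarrow>
     path (proj_product m p) (c mod m, tm_shift X (c div m)) w r"
    using Cons.prems e by (simp add: trans_proj_product_iff c_def)
  also have "\<dots> \<longleftrightarrow> r = ((2 ^ N * (c mod m) + v) mod m,
      tm_shift (tm_shift X (c div m)) ((2 ^ N * (c mod m) + v) div m))"
    unfolding N_def v_def using m by (intro Cons.IH[OF w]) simp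
  also have "tm_shift (tm_shift X (c div m)) ((2 ^ N * (c mod m) + v) div m) =
      tm_shift X (2 ^ N * (c div m) + (2 ^ N * (c mod m) + v) div m)"
    using lt by (simp add: tm_shift_block)
  finally show ?case using m unfolding split by simp
qed

lemma in_lang_from_proj_product_iff:
  assumes "i < m"
  shows "w \<in> lang_from (proj_product m p) (i, X) \<longleftrightarrow>
    w \<in> lists (digits (2 ^ p)) \<and>
    m dvd 2 ^ (p * length w) * i + val (2 ^ p) w \<and>
    tm_shift X ((2 ^ (p * length w) * i + val (2 ^ p) w) div m) = T"
proof (cases "w \<in> lists (digits (2 ^ p))")
  case True
  then have "w \<in> lang_from (proj_product m p) (i, X) \<longleftrightarrow>
      path (proj_product m p) (i, X) w (0, T)"
    by (simp add: lang_from_def proj_product_simps)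
  also have "\<dots> \<longleftrightarrow> m dvd 2 ^ (p * length w) * i + val (2 ^ p) w \<and>
      tm_shift X ((2 ^ (p * length w) * i + val (2 ^ p) w) div m) = T"
    unfolding path_proj_product_iff[OF True assms] dvd_eq_mod_eq_0 prod.inject by metis
  finally show ?thesis using True by blast
qed (simp add: lang_from_def proj_product_simps)

lemma lang_proj_product:
  assumes "m > 0"
  shows "lang (proj_product m p) = val_inv (2 ^ p) ((*) m ` thue_morse)"
proof -
  have "m dvd v \<and> tm_shift T (v div m) = T \<longleftrightarrow> v \<in> (*) m ` thue_morse" for v
    using assms by (auto simp: tm_shift_def split: if_splits)
  then show ?thesis
    using in_lang_from_proj_product_iff[OF assms, of _ p T]
    by (auto simp: lang_def val_inv_def proj_product_simps)
qed

lemma wf_proj_product: "m > 0 \<Longrightarrow> wf_automaton (proj_product m p)"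
  unfolding wf_automaton_def proj_product_simps
  by (auto simp: proj_product_def digits_def intro!: finite_cartesian_product finite_tm_sym)

lemma deterministic_proj_product: "deterministic (proj_product m p)"
  unfolding deterministic_def by (auto simp: trans_proj_product_iff)

lemma complete_proj_product: "complete (proj_product m p)"
  unfolding complete_def by (auto simp: trans_proj_product_iff proj_product_simps digits_def)

text \<open>The number \<open>m * d + i\<close> has remainder \<open>i\<close> and quotient
  \<open>d\<close>, so a word of this value leads to \<open>(i, X)\<close> once \<open>d\<close>
  shifts \<open>T\<close> to \<open>X\<close>; 0 and 1 provide both symbols.\<close>

lemma accessible_proj_product:
  assumes "p > 0"
  shows "accessible (proj_product m p)"
  unfolding accessible_def proj_product_simps
proof clarify
  fix i :: nat and X assume i: "i \<in> {0..<m}"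
  obtain d :: nat where d: "tm_shift T d = X"
    by (metis bar.simps(1) tm_sym.exhaust one_notin_thue_morse tm_shift_0 tm_shift_def)
  let ?v = "m * d + i"
  have "?v < (2 ^ p) ^ ?v"
    using assms by (intro less_le_trans[OF less_exp[of ?v]]) (simp add: power_mono self_le_power)
  then obtain w where "w \<in> lists (digits (2 ^ p))" "val (2 ^ p) w = ?v"
    using val_surj by blast
  then show "\<exists>w \<in> lists (digits (2 ^ p)). path (proj_product m p) (0, T) w (i, X)"
    using i d by (intro bexI[of _ w]) (auto simp: path_proj_product_iff)
qed

subsection \<open>The classes of states\<close>

locale tm_multiple =
  fixes p m k z :: nat
  assumes p_pos: "p > 0" and odd_k: "odd k" and m_eq: "m = k * 2 ^ z"
begin

lemma k_pos: "k > 0"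
  using odd_k by (rule odd_pos)

lemma m_pos: "m > 0"
  using k_pos by (simp add: m_eq)

text \<open>Here \<open>j\<close> and \<open>l\<close> are remainder and quotient of the first
  component by \<open>k\<close>; \<open>X\<close> is recovered because shifting twice by
  \<open>l\<close> is the identity.\<close>

lemma state_decomp:
  "s \<in> states (proj_product m p) \<longleftrightarrow>
     (\<exists>j X l. j < k \<and> l < 2 ^ z \<and> s = (j + k * l, tm_shift X l))"
proof
  assume s: "s \<in> states (proj_product m p)"
  then have "fst s < 2 ^ z * k" by (auto simp: proj_product_simps m_eq mult.commute)
  then have "fst s div k < 2 ^ z" by (rule less_mult_imp_div_less)
  then show "\<exists>j X l. j < k \<and> l < 2 ^ z \<and> s = (j + k * l, tm_shift X l)"
    using k_pos
    by (intro exI[of _ "fst s mod k"] exI[of _ "tm_shift (snd s) (fst s div k)"]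
        exI[of _ "fst s div k"]) simp
next
  assume "\<exists>j X l. j < k \<and> l < 2 ^ z \<and> s = (j + k * l, tm_shift X l)"
  then obtain j X l where s: "j < k" "l < 2 ^ z" "s = (j + k * l, tm_shift X l)" by blast
  then have "k * (l + 1) \<le> k * 2 ^ z" by (intro mult_left_mono) auto
  then show "s \<in> states (proj_product m p)" using s by (simp add: proj_product_simps m_eq)
qed

lemma coords_unique:
  assumes "j < k" "j' < k"
  shows "(j + k * l, tm_shift X l) = (j' + k * l', tm_shift X' l') \<longleftrightarrow> j = j' \<and> X = X' \<and> l = l'"
proof
  assume *: "(j + k * l, tm_shift X l) = (j' + k * l', tm_shift X' l')"
  then have "(j + k * l) mod k = (j' + k * l') mod k" "(j + k * l) div k = (j' + k * l') div k"
    by simp_all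
  then have "j = j'" "l = l'" using assms by simp_all
  moreover have "X = X'" using * \<open>l = l'\<close> tm_shift_self by (metis prod.inject)
  ultimately show "j = j' \<and> X = X' \<and> l = l'" by simp
qed simp

text \<open>The length of the shortest word of zeros accepted from \<open>(k * l, tm_shift T l)\<close>.\<close>

definition rank :: "nat \<Rightarrow> nat" where
  "rank l = (if l = 0 then 0 else Suc ((z - 1 - multiplicity 2 l) div p))"

lemma multiplicity_less:
  fixes l :: nat
  assumes "l < 2 ^ z" "l \<noteq> 0"
  shows "multiplicity 2 l < z"
proof (rule ccontr)
  assume "\<not> multiplicity 2 l < z"
  then have "2 ^ z dvd l" using assms by (simp add: power_dvd_iff_le_multiplicity)
  then show False using assms by (auto dest: dvd_imp_le)
qed

text \<open>For \<open>l > 0\<close>, \<open>rank l\<close> is the ceiling of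
  \<open>z - multiplicity 2 l\<close> over \<open>p\<close>. Truncated subtraction does the right
  thing: if \<open>z \<le> p * n\<close>, the divisor is 1 and the condition holds.\<close>

lemma rank_le_iff:
  assumes "l < 2 ^ z"
  shows "rank l \<le> n \<longleftrightarrow> 2 ^ (z - p * n) dvd l"
proof (cases "l = 0")
  case False
  have "rank l \<le> n \<longleftrightarrow> (z - 1 - multiplicity 2 l) div p < n"
    using False by (simp add: rank_def Suc_le_eq)
  also have "\<dots> \<longleftrightarrow> z - 1 - multiplicity 2 l < n * p"
    using p_pos by (simp add: div_less_iff_less_mult)
  also have "\<dots> \<longleftrightarrow> z - p * n \<le> multiplicity 2 l"
    using multiplicity_less[OF assms False] by (auto simp: mult.commute)
  finally show ?thesis using False by (simp add: power_dvd_iff_le_multiplicity)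
qed (simp add: rank_def)

text \<open>As \<open>m\<close> divides \<open>2 ^ N * k\<close>, the term in \<open>l\<close>
  leaves the remainder alone and adds \<open>2 ^ (N - z) * l\<close> to a quotient below
  \<open>2 ^ (N - z)\<close>. The two blocks separate, and the resulting shift by \<open>l\<close>
  cancels the one in the state.\<close>

lemma accept_long_iff:
  assumes "j < k" "v < 2 ^ N" "z \<le> N"
  shows "m dvd 2 ^ N * (j + k * l) + v \<and>
      tm_shift (tm_shift X l) ((2 ^ N * (j + k * l) + v) div m) = T \<longleftrightarrow>
    m dvd 2 ^ N * j + v \<and> tm_shift X ((2 ^ N * j + v) div m) = T"
proof -
  have pow: "(2::nat) ^ N = 2 ^ z * 2 ^ (N - z)" using assms by (simp flip: power_add)
  then have "2 ^ N * k = 2 ^ (N - z) * m" by (simp only: m_eq mult_ac)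
  then have split: "2 ^ N * (j + k * l) + v = m * (2 ^ (N - z) * l) + (2 ^ N * j + v)"
    by (simp add: algebra_simps)
  have "2 ^ N * (j + 1) \<le> 2 ^ N * k" using assms by (intro mult_left_mono) auto
  then have "2 ^ N * j + v < 2 ^ (N - z) * m"
    using assms \<open>2 ^ N * k = 2 ^ (N - z) * m\<close> by simp
  then have "(2 ^ N * j + v) div m < 2 ^ (N - z)" by (rule less_mult_imp_div_less)
  moreover have "m dvd 2 ^ N * (j + k * l) + v \<longleftrightarrow> m dvd 2 ^ N * j + v"
    unfolding split by (metis dvd_add_right_iff dvd_triv_left)
  moreover have "(2 ^ N * (j + k * l) + v) div m = 2 ^ (N - z) * l + (2 ^ N * j + v) div m"
    unfolding split using m_pos by simp
  ultimately show ?thesis by (simp add: tm_shift_block)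
qed

text \<open>Now \<open>2 ^ N\<close> divides \<open>m\<close>, hence \<open>v\<close>, so
  \<open>v = 0\<close>; then \<open>k\<close> divides \<open>j\<close>, so \<open>j = 0\<close>. The
  quotient is \<open>l\<close> without \<open>z - N\<close> trailing zero bits, so its shift cancels
  the shift by \<open>l\<close> and leaves \<open>X\<close>.\<close>

lemma accept_short_iff:
  assumes "j < k" "v < 2 ^ N" "N < z"
  shows "m dvd 2 ^ N * (j + k * l) + v \<and>
      tm_shift (tm_shift X l) ((2 ^ N * (j + k * l) + v) div m) = T \<longleftrightarrow>
    j = 0 \<and> X = T \<and> v = 0 \<and> 2 ^ (z - N) dvd l"
proof -
  have "(2::nat) ^ z = 2 ^ N * 2 ^ (z - N)" using assms by (simp flip: power_add)
  then have m: "m = 2 ^ N * (k * 2 ^ (z - N))" by (simp only: m_eq mult_ac)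
  have zero: "j = 0 \<and> v = 0 \<and> 2 ^ (z - N) dvd l" if "m dvd 2 ^ N * (j + k * l) + v"
  proof -
    have "2 ^ N dvd 2 ^ N * (j + k * l) + v" using that m by (meson dvd_trans dvd_triv_left)
    then have "2 ^ N dvd v" by (metis dvd_add_right_iff dvd_triv_left)
    then have v: "v = 0" using assms by (auto dest: dvd_imp_le)
    then have *: "k * 2 ^ (z - N) dvd j + k * l" using that unfolding m by simp
    then have "k dvd j + k * l" by (meson dvd_trans dvd_triv_left)
    then have "k dvd j" by (metis dvd_add_left_iff dvd_triv_left)
    then have j: "j = 0" using assms by (auto dest: dvd_imp_le)
    then show ?thesis using v * k_pos by simp
  qed
  have shift: "m dvd 2 ^ N * (k * l) \<and> tm_shift (tm_shift X l) (2 ^ N * (k * l) div m) = X"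
    if l: "2 ^ (z - N) dvd l"
  proof -
    obtain d where d: "l = 2 ^ (z - N) * d" using l by (rule dvdE)
    then have "2 ^ N * (k * l) = m * d" unfolding m by simp
    then have "m dvd 2 ^ N * (k * l)" "2 ^ N * (k * l) div m = d" using m_pos by simp_all
    moreover have "tm_shift Y l = tm_shift Y d" for Y unfolding d by (rule tm_shift_double)
    ultimately show ?thesis by simp
  qed
  show ?thesis using zero shift by auto
qed

section \<open>Languages of states in the coordinates \<open>j\<close>, \<open>X\<close>,
  \<open>l\<close>\<close>

abbreviation state_lang :: "nat \<Rightarrow> tm_sym \<Rightarrow> nat \<Rightarrow> nat list set" where
  "state_lang j X l \<equiv> lang_from (proj_product m p) (j + k * l, tm_shift X l)"

lemma in_state_lang_iff:
  assumes "j < k" "l < 2 ^ z"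
  shows "w \<in> state_lang j X l \<longleftrightarrow> w \<in> lists (digits (2 ^ p)) \<and>
    (if z \<le> p * length w
     then m dvd 2 ^ (p * length w) * j + val (2 ^ p) w \<and>
       tm_shift X ((2 ^ (p * length w) * j + val (2 ^ p) w) div m) = T
     else j = 0 \<and> X = T \<and> val (2 ^ p) w = 0 \<and> rank l \<le> length w)"
proof (cases "w \<in> lists (digits (2 ^ p))")
  case True
  have v: "val (2 ^ p) w < 2 ^ (p * length w)"
    using val_less[OF True] by (simp add: power_mult)
  have i: "j + k * l < m"
    using assms state_decomp[of "(j + k * l, tm_shift X l)"] by (auto simp: proj_product_simps)
  show ?thesis
    using True accept_long_iff[OF assms(1) v, of l X] accept_short_iff[OF assms(1) v, of l X]
    unfolding in_lang_from_proj_product_iff[OF i] rank_le_iff[OF assms(2)]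
    by (cases "z \<le> p * length w") simp_all
qed (simp add: lang_from_def proj_product_simps)

text \<open>Words of length \<open>n\<close> added to \<open>2 ^ N * j\<close> realize a whole
  interval of \<open>2 ^ N\<close> numbers. For large \<open>N\<close> it contains two multiples
  \<open>m * d\<close> whose factors \<open>d\<close> differ only in the last bit, and one of them
  gives \<open>T\<close>.\<close>

lemma long_word_exists:
  assumes "j < k"
  obtains w where "w \<in> lists (digits (2 ^ p))" "z \<le> p * length w"
    "m dvd 2 ^ (p * length w) * j + val (2 ^ p) w"
    "tm_shift X ((2 ^ (p * length w) * j + val (2 ^ p) w) div m) = T"
proof -
  \<comment> \<open>The part \<open>4 * m\<close> ensures \<open>3 * m < 2 ^ N\<close>, room for
    both candidate multiples; the part \<open>z\<close> makes the word long.\<close>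
  define n where "n = 4 * m + z"
  define N where "N = p * n"
  have "n \<le> N" using p_pos by (simp add: N_def)
  moreover have "N < 2 ^ N" by (rule less_exp)
  ultimately have big: "3 * m < 2 ^ N" and z: "z \<le> N" using m_pos unfolding n_def by linarith+
  define c where "c = 2 ^ N * j div (2 * m)"
  have c: "2 * m * c \<le> 2 ^ N * j" "2 ^ N * j < 2 * m * c + 2 * m"
    using mult_div_mod_eq[of "2 * m" "2 ^ N * j"] mod_less_divisor[of "2 * m" "2 ^ N * j"] m_pos
    unfolding c_def by linarith+
  \<comment> \<open>The Thue-Morse sequence takes both values on \<open>{2 * e, 2 * e + 1}\<close>.\<close>
  have "tm_shift X (2 * (c + 1)) = T \<or> tm_shift X (2 * (c + 1) + 1) = T"
    using tm_shift_double[of X 1 "c + 1"] tm_shift_odd[of X "c + 1"]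
    by (cases "tm_shift X (c + 1)") simp_all
  then obtain d where d: "d = 2 * (c + 1) \<or> d = 2 * (c + 1) + 1" and T: "tm_shift X d = T"
    by blast
  have "m * d = 2 * m * c + 2 * m \<or> m * d = 2 * m * c + 3 * m"
    using d by (auto simp: algebra_simps)
  then have v: "2 ^ N * j \<le> m * d" "m * d - 2 ^ N * j < 2 ^ N" using c big by linarith+
  then obtain w where w: "w \<in> lists (digits (2 ^ p))" "length w = n"
      "val (2 ^ p) w = m * d - 2 ^ N * j"
    using val_surj[of "m * d - 2 ^ N * j" "2 ^ p" n] by (auto simp: N_def power_mult)
  then have "2 ^ (p * length w) * j + val (2 ^ p) w = m * d" using v by (simp add: N_def)
  then show ?thesis using w z T m_pos by (intro that[of w]) (simp_all add: N_def)
qed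

text \<open>Modulo \<open>k\<close> the power of 2 is invertible because \<open>k\<close> is odd, so
  \<open>j\<close> is determined below \<open>k\<close>.\<close>

lemma residue_unique:
  assumes "m dvd 2 ^ N * j + v" "m dvd 2 ^ N * j' + v" "j \<le> j'" "j' < k"
  shows "j = j'"
proof -
  have "k dvd 2 ^ N * j' + v" "k dvd 2 ^ N * j + v" using assms m_eq by auto
  then have "k dvd (2 ^ N * j' + v) - (2 ^ N * j + v)" by (rule dvd_diff_nat)
  then have "k dvd 2 ^ N * (j' - j)" by (simp add: diff_mult_distrib2)
  then have "k dvd j' - j" using odd_k by (simp add: coprime_dvd_mult_right_iff)
  then show ?thesis using assms by (auto dest: dvd_imp_le)
qed

text \<open>The separating word has value 0 and length \<open>rank l\<close>. If it is already long,
  \<open>rank_le_iff\<close> bounds \<open>rank l'\<close> by its length directly.\<close>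

lemma state_lang_eq_imp_rank_le:
  assumes "l < 2 ^ z" "l' < 2 ^ z" "state_lang 0 T l = state_lang 0 T l'"
  shows "rank l' \<le> rank l"
proof -
  obtain w where w: "w \<in> lists (digits (2 ^ p))" "length w = rank l" "val (2 ^ p) w = 0"
    using val_surj[of 0 "2 ^ p" "rank l"] by auto
  have "w \<in> state_lang 0 T l"
    unfolding in_state_lang_iff[OF k_pos assms(1)] using w by simp
  then have "z \<le> p * rank l \<or> rank l' \<le> rank l"
    unfolding assms(3) in_state_lang_iff[OF k_pos assms(2)] using w by (simp split: if_splits)
  then show ?thesis using rank_le_iff[OF assms(2), of "rank l"] by auto
qed

text \<open>One long word accepted from both states fixes \<open>j\<close> by its residue and then
  \<open>X\<close> by the common quotient. Only for \<open>(0, T)\<close> do short words see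
  \<open>l\<close>, and then only through its rank.\<close>

lemma state_lang_eq_iff:
  assumes "j < k" "j' < k" "l < 2 ^ z" "l' < 2 ^ z"
  shows "state_lang j X l = state_lang j' X' l' \<longleftrightarrow>
    j = j' \<and> X = X' \<and> ((j, X) = (0, T) \<longrightarrow> rank l = rank l')"
proof
  assume eq: "state_lang j X l = state_lang j' X' l'"
  obtain w where w: "w \<in> lists (digits (2 ^ p))" "z \<le> p * length w"
    "m dvd 2 ^ (p * length w) * j + val (2 ^ p) w"
    "tm_shift X ((2 ^ (p * length w) * j + val (2 ^ p) w) div m) = T"
    using long_word_exists assms(1) by blast
  then have "w \<in> state_lang j X l" unfolding in_state_lang_iff[OF assms(1,3)] by simp
  then have w': "m dvd 2 ^ (p * length w) * j' + val (2 ^ p) w"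
    "tm_shift X' ((2 ^ (p * length w) * j' + val (2 ^ p) w) div m) = T"
    unfolding eq in_state_lang_iff[OF assms(2,4)] using w by simp_all
  have "j = j'"
    using residue_unique[OF w(3) w'(1)] residue_unique[OF w'(1) w(3)] assms by linarith
  moreover have "X = X'"
    using w(4) w'(2) unfolding \<open>j = j'\<close> tm_shift_def by (metis bar_bar)
  ultimately show "j = j' \<and> X = X' \<and> ((j, X) = (0, T) \<longrightarrow> rank l = rank l')"
    using eq assms state_lang_eq_imp_rank_le by (metis le_antisym prod.inject)
next
  assume "j = j' \<and> X = X' \<and> ((j, X) = (0, T) \<longrightarrow> rank l = rank l')"
  then show "state_lang j X l = state_lang j' X' l'"
    using assms by (intro set_eqI) (auto simp: in_state_lang_iff)
qed

section \<open>The classes \<open>C_class\<close> and \<open>Gamma_class\<close> in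
  coordinates\<close>

lemma less_num_Gamma_iff: "\<beta> < num_Gamma z p \<longleftrightarrow> \<beta> * p < z"
proof -
  have "\<beta> < num_Gamma z p \<longleftrightarrow> int \<beta> < \<lceil>real z / real p\<rceil>"
    unfolding num_Gamma_def by linarith
  also have "\<dots> \<longleftrightarrow> real \<beta> < real z / real p" by (simp add: less_ceiling_iff)
  also have "\<dots> \<longleftrightarrow> real (\<beta> * p) < real z" using p_pos by (simp add: pos_less_divide_eq)
  finally show ?thesis unfolding of_nat_less_iff .
qed

text \<open>Numbers of valuation \<open>e = z - 1 - \<alpha>\<close> are
  \<open>2 ^ e * (2 * h + 1)\<close>. The appended bit 1 flips the symbol and the trailing zeros
  keep it, which turns \<open>B\<close> shifted by \<open>h\<close> into \<open>T\<close> shifted by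
  \<open>l\<close>.\<close>

lemma C_class_eq:
  assumes "\<alpha> < z"
  shows "C_class k z \<alpha> =
    {(k * l, tm_shift T l) | l. 0 < l \<and> l < 2 ^ z \<and> multiplicity 2 l = z - 1 - \<alpha>}"
proof -
  define e where "e = z - 1 - \<alpha>"
  have z: "z = e + Suc \<alpha>" using assms by (simp add: e_def)
  have elem: "(k * 2 ^ (z - \<alpha> - 1) + k * 2 ^ (z - \<alpha>) * h, tm_shift B h) =
      (k * (2 ^ e * (2 * h + 1)), tm_shift T (2 ^ e * (2 * h + 1)))" for h
    unfolding tm_shift_double tm_shift_odd
    by (simp add: z algebra_simps) (simp add: tm_shift_def)
  have "(\<exists>h. h < 2 ^ \<alpha> \<and> l = 2 ^ e * (2 * h + 1)) \<longleftrightarrow>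
      0 < l \<and> l < 2 ^ z \<and> multiplicity 2 l = e" for l :: nat
  proof
    assume "\<exists>h. h < 2 ^ \<alpha> \<and> l = 2 ^ e * (2 * h + 1)"
    then obtain h where h: "h < 2 ^ \<alpha>" and l: "l = 2 ^ e * (2 * h + 1)" by blast
    have "multiplicity 2 l = e" unfolding l by (rule multiplicity_decomposeI[of _ _ _ "2 * h + 1"]) auto
    moreover have "2 ^ e * (2 * h + 1) < 2 ^ e * (2 * 2 ^ \<alpha>)"
      by (rule mult_strict_left_mono) (use h in simp_all)
    then have "l < 2 ^ z" by (simp only: l z power_add power_Suc)
    ultimately show "0 < l \<and> l < 2 ^ z \<and> multiplicity 2 l = e" using l by simp
  next
    assume *: "0 < l \<and> l < 2 ^ z \<and> multiplicity 2 l = e"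
    then obtain y where y: "l = 2 ^ e * y" "odd y"
      using multiplicity_decompose'[of l 2] by auto
    then obtain h where h: "y = 2 * h + 1" using oddE by blast
    have "2 ^ e * y < 2 ^ e * (2 * 2 ^ \<alpha>)" using * y by (simp add: z power_add)
    then have "y < 2 * 2 ^ \<alpha>" by (rule mult_left_less_imp_less) simp
    then show "\<exists>h. h < 2 ^ \<alpha> \<and> l = 2 ^ e * (2 * h + 1)" using h y by auto
  qed
  then have "{l :: nat. 0 < l \<and> l < 2 ^ z \<and> multiplicity 2 l = e} =
      (\<lambda>h. 2 ^ e * (2 * h + 1)) ` {h. h < 2 ^ \<alpha>}"
    by (simp only: image_def Bex_def mem_Collect_eq)
  then show ?thesis
    unfolding C_class_def elem e_def[symmetric] setcompr_eq_image by (simp only: image_image)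
qed

lemma Gamma_class_eq:
  "Gamma_class k z p \<beta> = {(k * l, tm_shift T l) | l. 0 < l \<and> l < 2 ^ z \<and> rank l = Suc \<beta>}"
proof -
  have "Gamma_class k z p \<beta> = (\<Union>\<alpha> \<in> {\<alpha>. \<alpha> < z \<and> \<alpha> div p = \<beta>}. C_class k z \<alpha>)"
  proof -
    have div: "\<alpha> div p = \<beta> \<longleftrightarrow> \<beta> * p \<le> \<alpha> \<and> \<alpha> < \<beta> * p + p" for \<alpha>
    proof -
      have "\<alpha> < \<beta> * p + p \<longleftrightarrow> \<alpha> div p < Suc \<beta>"
        using div_less_iff_less_mult[OF p_pos, of \<alpha> "Suc \<beta>"] by (simp add: add.commute)
      moreover have "\<beta> * p \<le> \<alpha> \<longleftrightarrow> \<beta> \<le> \<alpha> div p"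
        using less_eq_div_iff_mult_less_eq[OF p_pos] by simp
      ultimately show ?thesis by auto
    qed
    \<comment> \<open>In the first branch the block of length \<open>p\<close> ends below
      \<open>z\<close>; in the second, \<open>z\<close> is at most \<open>\<beta> * p + p\<close>
      and cuts it off.\<close>
    have "(if \<beta> + 1 < num_Gamma z p then {\<beta> * p ..< \<beta> * p + p} else {\<beta> * p ..< z}) =
        {\<alpha>. \<alpha> < z \<and> \<alpha> div p = \<beta>}"
      unfolding less_num_Gamma_iff div by auto
    then show ?thesis unfolding Gamma_class_def by metis
  qed
  also have "\<dots> = {(k * l, tm_shift T l) | l. 0 < l \<and> l < 2 ^ z \<and> rank l = Suc \<beta>}"
  proof -
    have "(\<exists>\<alpha>. \<alpha> < z \<and> \<alpha> div p = \<beta> \<and> multiplicity 2 l = z - 1 - \<alpha>) \<longleftrightarrow> rank l = Suc \<beta>"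
      if l: "0 < l" "l < 2 ^ z" for l
    proof -
      have mult: "multiplicity 2 l < z" using multiplicity_less l by simp
      have "(\<alpha> < z \<and> multiplicity 2 l = z - 1 - \<alpha>) \<longleftrightarrow> \<alpha> = z - 1 - multiplicity 2 l" for \<alpha>
        using mult by auto
      then have "(\<exists>\<alpha>. \<alpha> < z \<and> \<alpha> div p = \<beta> \<and> multiplicity 2 l = z - 1 - \<alpha>) \<longleftrightarrow>
          (z - 1 - multiplicity 2 l) div p = \<beta>"
        by metis
      then show ?thesis using l by (simp add: rank_def)
    qed
    then have "(\<exists>\<alpha>. (\<alpha> < z \<and> \<alpha> div p = \<beta>) \<and> 0 < l \<and> l < 2 ^ z \<and> multiplicity 2 l = z - 1 - \<alpha>)
        \<longleftrightarrow> 0 < l \<and> l < 2 ^ z \<and> rank l = Suc \<beta>" for l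
      by blast
    moreover have "(\<Union>\<alpha> \<in> {\<alpha>. \<alpha> < z \<and> \<alpha> div p = \<beta>}. C_class k z \<alpha>) =
        (\<lambda>l. (k * l, tm_shift T l)) ` {l. \<exists>\<alpha>. (\<alpha> < z \<and> \<alpha> div p = \<beta>) \<and>
           0 < l \<and> l < 2 ^ z \<and> multiplicity 2 l = z - 1 - \<alpha>}"
      using C_class_eq by blast
    ultimately show ?thesis by (simp only: setcompr_eq_image)
  qed
  finally show ?thesis .
qed

text \<open>One indexing for both kinds of classes. For \<open>(0, T)\<close> the index
  \<open>r\<close> is the rank of the members: rank 0 gives the initial class and rank
  \<open>r > 0\<close> the class \<open>\<Gamma>\<close> with index \<open>r - 1\<close>.\<close>

definition cls :: "nat \<Rightarrow> tm_sym \<Rightarrow> nat \<Rightarrow> (nat \<times> tm_sym) set" where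
  "cls j X r = (if (j, X) = (0, T) \<and> r > 0 then Gamma_class k z p (r - 1)
     else state_class k z (j, X))"

lemma cls_eq:
  "cls j X r = {(j + k * l, tm_shift X l) | l. l < 2 ^ z \<and> ((j, X) = (0, T) \<longrightarrow> rank l = r)}"
proof (cases "(j, X) = (0, T)")
  case True
  show ?thesis
  proof (cases r)
    case 0
    have "rank l = 0 \<longleftrightarrow> l = 0" for l by (simp add: rank_def)
    then show ?thesis using True 0 by (auto simp: cls_def state_class_def)
  next
    case (Suc n)
    have "0 < l \<and> l < 2 ^ z \<and> rank l = Suc n \<longleftrightarrow> l < 2 ^ z \<and> rank l = Suc n" for l
      by (auto simp: rank_def)
    then show ?thesis using True Suc by (simp add: cls_def Gamma_class_eq)
  qed
next
  case False
  then show ?thesis by (auto simp: cls_def state_class_def)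
qed

lemma mem_cls_iff:
  assumes "j < k" "j' < k" "l < 2 ^ z"
  shows "(j + k * l, tm_shift X l) \<in> cls j' X' r \<longleftrightarrow>
    j = j' \<and> X = X' \<and> ((j, X) = (0, T) \<longrightarrow> rank l = r)"
proof -
  have "(j + k * l, tm_shift X l) \<in> cls j' X' r \<longleftrightarrow> (\<exists>l'. (j + k * l, tm_shift X l) =
      (j' + k * l', tm_shift X' l') \<and> l' < 2 ^ z \<and> ((j', X') = (0, T) \<longrightarrow> rank l' = r))"
    by (simp only: cls_eq mem_Collect_eq)
  also have "\<dots> \<longleftrightarrow> j = j' \<and> X = X' \<and> ((j, X) = (0, T) \<longrightarrow> rank l = r)"
    unfolding coords_unique[OF assms(1,2)] using assms(3) by metis
  finally show ?thesis .
qed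

lemma cls_cong: "((j, X) = (0, T) \<Longrightarrow> r = r') \<Longrightarrow> cls j X r = cls j X r'"
  unfolding cls_def by auto

lemma quotient_states_eq:
  "quotient_states k z p = {cls j X r | j X r. j < k \<and> r \<le> num_Gamma z p}"
proof (intro equalityI subsetI)
  fix J assume "J \<in> quotient_states k z p"
  then consider j X where "j < k" "J = state_class k z (j, X)"
    | \<beta> where "\<beta> < num_Gamma z p" "J = Gamma_class k z p \<beta>"
    unfolding quotient_states_def by auto
  then show "J \<in> {cls j X r | j X r. j < k \<and> r \<le> num_Gamma z p}"
  proof cases
    case 1
    then have "J = cls j X 0" by (simp add: cls_def)
    with 1 show ?thesis by blast
  next
    case 2
    then have "J = cls 0 T (Suc \<beta>)" by (simp add: cls_def)
    with 2 k_pos Suc_leI show ?thesis by blast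
  qed
next
  fix J assume "J \<in> {cls j X r | j X r. j < k \<and> r \<le> num_Gamma z p}"
  then obtain j X r where "j < k" "r \<le> num_Gamma z p" "J = cls j X r" by blast
  then show "J \<in> quotient_states k z p"
    by (auto simp: quotient_states_def cls_def)
qed

lemma rank_le_num_Gamma: "l < 2 ^ z \<Longrightarrow> rank l \<le> num_Gamma z p"
proof -
  assume l: "l < 2 ^ z"
  have "z \<le> num_Gamma z p * p" using less_num_Gamma_iff[of "num_Gamma z p"] by simp
  then have "z - p * num_Gamma z p = 0" by (simp add: mult.commute)
  then show "rank l \<le> num_Gamma z p" unfolding rank_le_iff[OF l] by simp
qed

text \<open>Names a class by the coordinates of any of its members, so that classes and languages
  can be compared on the same data.\<close>

lemma quotient_states_cases:
  assumes "J \<in> quotient_states k z p" "s \<in> J"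
  obtains j X l where "j < k" "l < 2 ^ z" "s = (j + k * l, tm_shift X l)" "J = cls j X (rank l)"
proof -
  obtain j X r where J: "j < k" "J = cls j X r"
    using assms(1) unfolding quotient_states_eq by auto
  then obtain l where "l < 2 ^ z" "s = (j + k * l, tm_shift X l)"
      "(j, X) = (0, T) \<longrightarrow> rank l = r"
    using assms(2) unfolding J(2) cls_eq mem_Collect_eq by metis
  moreover from this(3) have "J = cls j X (rank l)" unfolding J(2) by (metis cls_cong)
  ultimately show ?thesis using J(1) that by metis
qed

lemma cls_nonempty:
  assumes "r \<le> num_Gamma z p"
  shows "cls j X r \<noteq> {}"
proof -
  have "\<exists>l < 2 ^ z. rank l = r"
  proof (cases r)
    case 0
    then show ?thesis by (intro exI[of _ 0]) (simp add: rank_def)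
  next
    case (Suc \<beta>)
    then have \<beta>: "\<beta> * p < z" using assms less_num_Gamma_iff[of \<beta>] by (simp only: Suc_le_eq)
    \<comment> \<open>With this valuation the dividend in \<open>rank\<close> is exactly
      \<open>\<beta> * p\<close>.\<close>
    let ?l = "2 ^ (z - 1 - \<beta> * p) :: nat"
    have "multiplicity 2 ?l = z - 1 - \<beta> * p" by simp
    then have "rank ?l = r" using Suc \<beta> p_pos by (simp add: rank_def)
    moreover have "?l < 2 ^ z" using \<beta> by simp
    ultimately show ?thesis by blast
  qed
  then show ?thesis unfolding cls_eq by blast
qed

section \<open>The automaton of classes as a quotient by language equality\<close>

lemma M_automaton_simps:
  "states (M_automaton m p) = quotient_states k z p"
  "alphabet (M_automaton m p) = digits (2 ^ p)"
  "initial (M_automaton m p) = cls 0 T 0"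
  "final (M_automaton m p) = {cls 0 T 0}"
  "trans_rel (M_automaton m p) = {(J1, a, J2).
     J1 \<in> quotient_states k z p \<and> a \<in> digits (2 ^ p) \<and> J2 \<in> quotient_states k z p \<and>
     (\<exists>j1 \<in> J1. \<exists>j2 \<in> J2. (j1, a, j2) \<in> trans_rel (proj_product m p))}"
proof -
  have "multiplicity 2 m = z"
    using odd_k by (intro multiplicity_decomposeI[of _ _ _ k]) (auto simp: m_eq)
  moreover have "m div 2 ^ z = k" by (simp add: m_eq)
  ultimately show
    "states (M_automaton m p) = quotient_states k z p"
    "alphabet (M_automaton m p) = digits (2 ^ p)"
    "initial (M_automaton m p) = cls 0 T 0"
    "final (M_automaton m p) = {cls 0 T 0}"
    "trans_rel (M_automaton m p) = {(J1, a, J2).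
       J1 \<in> quotient_states k z p \<and> a \<in> digits (2 ^ p) \<and> J2 \<in> quotient_states k z p \<and>
       (\<exists>j1 \<in> J1. \<exists>j2 \<in> J2. (j1, a, j2) \<in> trans_rel (proj_product m p))}"
    by (simp_all add: M_automaton_def cls_def)
qed

text \<open>Equality of classes (\<open>mem_cls_iff\<close>) and equality of languages
  (\<open>state_lang_eq_iff\<close>) amount to the same condition on coordinates.\<close>

lemma nerode_quotient_M_automaton: "nerode_quotient (proj_product m p) (M_automaton m p)"
proof
  let ?A = "proj_product m p" and ?M = "M_automaton m p"
  note M_automaton_simps [simp]
  show "wf_automaton ?A" "deterministic ?A" "complete ?A" "accessible ?A"
    using wf_proj_product deterministic_proj_product complete_proj_product
      accessible_proj_product m_pos p_pos by auto
  have in_cls: "(j + k * l, tm_shift X l) \<in> cls j X (rank l)" if "j < k" "l < 2 ^ z" for j l X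
    using that by (simp add: mem_cls_iff)
  show "\<Union> (states ?M) = states ?A"
  proof (intro equalityI subsetI)
    fix s assume "s \<in> \<Union> (states ?M)"
    then obtain J where "J \<in> quotient_states k z p" "s \<in> J" by auto
    then show "s \<in> states ?A" unfolding state_decomp using quotient_states_cases by metis
  next
    fix s assume "s \<in> states ?A"
    then obtain j X l where s: "j < k" "l < 2 ^ z" "s = (j + k * l, tm_shift X l)"
      unfolding state_decomp by blast
    then have "cls j X (rank l) \<in> states ?M"
      using rank_le_num_Gamma by (auto simp: quotient_states_eq)
    then show "s \<in> \<Union> (states ?M)" using in_cls s by blast
  qed
  show "{} \<notin> states ?M"
    using cls_nonempty by (auto simp: quotient_states_eq)
  show "lang_from ?A s = lang_from ?A s' \<longleftrightarrow> J = J'"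
    if J: "J \<in> states ?M" "J' \<in> states ?M" "s \<in> J" "s' \<in> J'" for J J' s s'
  proof -
    have Q: "J \<in> quotient_states k z p" "J' \<in> quotient_states k z p" using J(1,2) by simp_all
    obtain j X l where s: "j < k" "l < 2 ^ z" "s = (j + k * l, tm_shift X l)"
        "J = cls j X (rank l)"
      using Q(1) J(3) by (rule quotient_states_cases)
    obtain j' X' l' where s': "j' < k" "l' < 2 ^ z" "s' = (j' + k * l', tm_shift X' l')"
        "J' = cls j' X' (rank l')"
      using Q(2) J(4) by (rule quotient_states_cases)
    have "J = J' \<longleftrightarrow> j = j' \<and> X = X' \<and> ((j, X) = (0, T) \<longrightarrow> rank l = rank l')"
    proof
      assume "J = J'"
      then have "(j + k * l, tm_shift X l) \<in> cls j' X' (rank l')" using J s s' by simp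
      then show "j = j' \<and> X = X' \<and> ((j, X) = (0, T) \<longrightarrow> rank l = rank l')"
        using mem_cls_iff s s' by blast
    qed (metis s(4) s'(4) cls_cong)
    moreover have "lang_from ?A s = lang_from ?A s' \<longleftrightarrow>
        j = j' \<and> X = X' \<and> ((j, X) = (0, T) \<longrightarrow> rank l = rank l')"
      unfolding s(3) s'(3) by (rule state_lang_eq_iff[OF s(1) s'(1) s(2) s'(2)])
    ultimately show ?thesis by metis
  qed
  show "alphabet ?M = alphabet ?A" by (simp add: proj_product_simps)
  show "initial ?M \<in> states ?M" using k_pos by (auto simp: quotient_states_eq)
  \<comment> \<open>The state \<open>(0, T)\<close> has \<open>j = 0\<close>, \<open>l = 0\<close>
    and rank 0, so \<open>cls 0 T 0\<close> is the only class containing it, which settles both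
    initial and final states.\<close>
  have init: "(0, T) \<in> cls j X r \<longleftrightarrow> (j, X, r) = (0, T, 0)" if "j < k" for j X r
    using mem_cls_iff[OF k_pos that, of 0 T] by (auto simp: rank_def)
  show "initial ?A \<in> initial ?M" using init[OF k_pos] by (simp add: proj_product_simps)
  have "{cls 0 T 0} = {J \<in> quotient_states k z p. (0, T) \<in> J}"
    using init k_pos by (auto simp: quotient_states_eq)
  then show "final ?M = {J \<in> states ?M. \<exists>s \<in> J. s \<in> final ?A}"
    by (simp add: proj_product_simps)
  show "trans_rel ?M = {(J1, a, J2). J1 \<in> states ?M \<and> a \<in> alphabet ?A \<and> J2 \<in> states ?M \<and>
      (\<exists>j1 \<in> J1. \<exists>j2 \<in> J2. (j1, a, j2) \<in> trans_rel ?A)}"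
    by (simp add: proj_product_simps)
qed

end

theorem theorem47:
  fixes p m :: nat
  assumes "p > 0" and "m > 0"
  shows "minimal_automaton_of (M_automaton m p) (val_inv (2 ^ p) ((*) m ` thue_morse))"
proof -
  have "m \<noteq> 0" "\<not> is_unit (2 :: nat)" using assms by simp_all
  then obtain k where k: "m = 2 ^ multiplicity 2 m * k" "odd k"
    by (rule multiplicity_decompose')
  interpret tm_multiple p m k "multiplicity 2 m"
  proof
    show "m = k * 2 ^ multiplicity 2 m" by (subst mult.commute) (rule k(1))
  qed (fact assms(1) k(2))+
  show ?thesis
    using nerode_quotient.minimal[OF nerode_quotient_M_automaton] lang_proj_product[OF assms(2)]
    by simp
qed

end
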